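(* Let $\mathcal M^2=(\mathbb R^2,l)$ be the Minkowski plane whose unit ball is a smooth, centrally symmetric, strictly convex body $\mathcal U\subset\mathbb R^2$ with $0\in\operatorname{int}\mathcal U$, with indicatrix $\partial\mathcal U$ and isoperimetrix $\mathcal I$. Let $\gamma:\mathbb S^1\to\mathcal M^2$ be a smooth, simple, strictly convex (closed) curve, positively oriented, with Minkowski normal $N$ and Minkowski curvature $\kappa>0$. Let $e:=\gamma+\kappa^{-1}N$ be the Minkowski evolute, regarded as a closed front, and let $\mathscr A(e)$ denote its signed Euclidean area. Then $$\mathscr L(\gamma)^2-4\,\mathscr A(\gamma)\,\mathscr A(\mathcal I)\le 4\,\mathscr A(\mathcal I)\,|\mathscr A(e)|.$$
   Context: Write $\partial\mathcal U=\{r(\theta)(\cos\theta,\sin\theta):\theta\in[0,2\pi)\}$ with $r>0$ smooth and $r(\theta+\pi)=r(\theta)$. The norm is $l(x)=\inf\{s>0:x\in s\,\mathcal U\}$. Set $h(\theta):=r(\theta)^{-1}$ (the support function of the polar dual body of $\mathcal U$). Smooth strict convexity of $\mathcal U$ means $h_{\theta\theta}+h>0$. Let $\tau=(\cos\theta,\sin\theta)$, $n=(-\sin\theta,\cos\theta)$. For a smooth closed curve $\gamma$ with Euclidean arclength $s$ and Euclidean unit tangent $\gamma_s=\tau(\theta)$ of angle $\theta$, the Euclidean curvature is $k=\theta_s$. Strictly convex closed curves are oriented positively (counterclockwise), so that $k>0$. The Minkowski arclength element is $d\sigma=h(\theta)\,ds$, the Minkowski length is $\mathscr L(\gamma)=\int_{\mathbb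 S^1}l(\gamma_u)\,du=\int_\gamma d\sigma$, the Minkowski normal is $N=-h_\theta\tau+h\,n$ (evaluated at the tangent angle $\theta$ of $\gamma$), and the Minkowski curvature is $\kappa=k(h_{\theta\theta}+h)$. With $x\wedge y:=x_1y_2-x_2y_1$, the signed Euclidean area of a closed $C^1$ map $c:\mathbb S^1\to\mathbb R^2$ is $\mathscr A(c)=\frac12\int_{\mathbb S^1}c\wedge c_u\,du$. For a positively oriented simple closed curve this is the enclosed area. The isoperimetrix is the closed curve $\mathcal I=\{-h_\theta\tau+h\,n:\theta\in[0,2\pi)\}$, parametrised by $\theta$, and $\mathscr A(\mathcal I)$ is its (enclosed) Euclidean area. *)

theory Defs
  imports "HOL-Analysis.Analysis"
begin

definition wedge :: "real^2 \<Rightarrow> real^2 \<Rightarrow> real" where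
  "wedge x y = x$1 * y$2 - x$2 * y$1"

definition tau :: "real \<Rightarrow> real^2" where
  "tau t = vector [cos t, sin t]"

definition nrm :: "real \<Rightarrow> real^2" where
  "nrm t = vector [- sin t, cos t]"

definition velocity :: "(real \<Rightarrow> 'a::real_normed_vector) \<Rightarrow> real \<Rightarrow> 'a" where
  "velocity c u = vector_derivative c (at u)"

definition smooth :: "(real \<Rightarrow> 'a::real_normed_vector) \<Rightarrow> bool" where
  "smooth c \<longleftrightarrow> (\<forall>m u. (velocity ^^ m) c differentiable at u)"

text \<open>A map on the circle is given by its \<open>2\<pi>\<close>-periodic lift to the real line, and integrals
  over the circle are integrals over \<open>[0, 2\<pi>]\<close>.\<close>

definition signed_area :: "(real \<Rightarrow> real^2) \<Rightarrow> real" where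
  "signed_area c = 1/2 * integral {0..2*pi} (\<lambda>u. wedge (c u) (velocity c u))"


subsection \<open>The Minkowski plane\<close>

definition hfun :: "(real \<Rightarrow> real) \<Rightarrow> real \<Rightarrow> real" where
  "hfun r t = inverse (r t)"

text \<open>\<open>U\<close> is the unit body and \<open>r\<close> the radial function of its boundary.  The last conjunct is
  smooth strict convexity: the curvature of \<open>\<theta> \<mapsto> r \<tau>\<close> has the sign of \<open>h'' + h\<close>.\<close>

definition minkowski_unit_body :: "(real^2) set \<Rightarrow> (real \<Rightarrow> real) \<Rightarrow> bool" where
  "minkowski_unit_body U r \<longleftrightarrow>
     compact U \<and> convex U \<and> 0 \<in> interior U \<and> (\<forall>x\<in>U. - x \<in> U) \<and>
     frontier U = {r t *\<^sub>R tau t | t. 0 \<le> t \<and> t < 2*pi} \<and>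
     smooth r \<and> (\<forall>t. r t > 0) \<and> (\<forall>t. r (t + pi) = r t) \<and>
     (\<forall>t. deriv (deriv (hfun r)) t + hfun r t > 0)"

definition mnorm :: "(real^2) set \<Rightarrow> real^2 \<Rightarrow> real" where
  "mnorm U x = Inf {s. s > 0 \<and> x \<in> (\<lambda>y. s *\<^sub>R y) ` U}"

definition isoperimetrix :: "(real \<Rightarrow> real) \<Rightarrow> real \<Rightarrow> real^2" where
  "isoperimetrix r t = - (deriv (hfun r) t) *\<^sub>R tau t + hfun r t *\<^sub>R nrm t"


subsection \<open>Curves\<close>

definition smooth_closed_curve :: "(real \<Rightarrow> real^2) \<Rightarrow> bool" where
  "smooth_closed_curve c \<longleftrightarrow>
     smooth c \<and> (\<forall>u. c (u + 2*pi) = c u) \<and> (\<forall>u. velocity c u \<noteq> 0)"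

definition simple_closed :: "(real \<Rightarrow> real^2) \<Rightarrow> bool" where
  "simple_closed c \<longleftrightarrow> inj_on c {0..<2*pi}"

text \<open>The closed region bounded by the curve is strictly convex.\<close>

definition strictly_convex_curve :: "(real \<Rightarrow> real^2) \<Rightarrow> bool" where
  "strictly_convex_curve c \<longleftrightarrow>
     (\<forall>x \<in> range c \<union> inside (range c). \<forall>y \<in> range c \<union> inside (range c).
        x \<noteq> y \<longrightarrow> open_segment x y \<subseteq> inside (range c))"

text \<open>Counterclockwise: the enclosed region lies to the left of the direction of travel.\<close>

definition positively_oriented :: "(real \<Rightarrow> real^2) \<Rightarrow> bool" where
  "positively_oriented c \<longleftrightarrow>
     (\<forall>u. \<forall>\<^sub>F t in at_right 0.
        c u + t *\<^sub>R vector [- (velocity c u)$2, (velocity c u)$1] \<in> inside (range c))"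

text \<open>\<open>th\<close> is a differentiable determination of the angle of the Euclidean unit tangent.
  It is unique up to a constant in \<open>2\<pi>\<int>\<close>, on which nothing below depends.  It is a function of
  the real parameter only: along a counterclockwise convex curve it grows by \<open>2\<pi>\<close> per period.\<close>

definition tangent_angle :: "(real \<Rightarrow> real^2) \<Rightarrow> (real \<Rightarrow> real) \<Rightarrow> bool" where
  "tangent_angle c th \<longleftrightarrow>
     (\<forall>u. th differentiable at u \<and> velocity c u = norm (velocity c u) *\<^sub>R tau (th u))"

lemma tangent_angle_exists:
  assumes "smooth_closed_curve c"
  shows "\<exists>th. tangent_angle c th"
proof -
  define v where "v = velocity c"
  have sm: "((velocity ^^ m) c) differentiable at u" for m u
    using assms unfolding smooth_closed_curve_def smooth_def by blast
  have dv: "(v has_vector_derivative velocity v u) (at u)" for u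
    using sm[of 1 u] by (simp add: v_def velocity_def[of "velocity c"] vector_derivative_works)
  have v0: "v u \<noteq> 0" for u
    using assms by (simp add: smooth_closed_curve_def v_def)
  have cont': "continuous_on UNIV (velocity v)"
    using sm[of 2] unfolding v_def
    by (auto simp: continuous_on_eq_continuous_at numeral_2_eq_2
        intro: differentiable_imp_continuous_within)
  define J where "J = (\<lambda>x::real^2. Complex (x$1) (x$2))"
  have J: "bounded_linear J"
    unfolding J_def
    by (rule linear_conv_bounded_linear[THEN iffD1]) (auto intro!: linearI simp: complex_eq_iff)
  define w where "w = (\<lambda>u. J (v u))"
  define w' where "w' = (\<lambda>u. J (velocity v u))"
  have dw: "(w has_vector_derivative w' u) (at u)" for u
    unfolding w_def w'_def by (rule bounded_linear.has_vector_derivative[OF J dv])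
  have w0: "w u \<noteq> 0" for u
    using v0[of u] by (auto simp: w_def J_def complex_eq_iff vec_eq_iff forall_2)
  have cw: "continuous_on UNIV w"
    using dw by (auto simp: continuous_on_eq_continuous_at
        intro: has_vector_derivative_continuous)
  have cw': "continuous_on UNIV w'"
    unfolding w'_def by (rule bounded_linear.continuous_on[OF J cont'])
  have "continuous_on UNIV (\<lambda>u. w' u / w u)"
    by (intro continuous_intros cw cw') (use w0 in auto)
  then have "\<exists>F. \<forall>x :: real. (-\<infinity>::ereal) < x \<longrightarrow> x < (\<infinity>::ereal) \<longrightarrow>
      (F has_vector_derivative (w' x / w x)) (at x)"
    by (intro einterval_antiderivative) (auto simp: continuous_on_eq_continuous_at)
  then obtain F where F: "(F has_vector_derivative (w' x / w x)) (at x)" for x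
    by auto
  have "((\<lambda>u. w u * exp (- F u)) has_vector_derivative 0) (at u)" for u
  proof -
    have "((\<lambda>u. exp (- F u)) has_vector_derivative (- (w' u / w u)) * exp (- F u)) (at u)"
      using field_vector_diff_chain_at[OF has_vector_derivative_minus[OF F] DERIV_exp]
      by (simp add: o_def)
    from has_vector_derivative_mult[OF dw this] show ?thesis
      using w0[of u] by (simp add: field_simps)
  qed
  then obtain K where K: "w u * exp (- F u) = K" for u
    using has_vector_derivative_zero_constant[of UNIV "\<lambda>u. w u * exp (- F u)"] by auto
  have K0: "K \<noteq> 0" using K[of 0] w0[of 0] by auto
  have w: "w u = exp (F u + Ln K)" for u
    using K[of u] K0 by (simp add: exp_add exp_minus field_simps)
  define th where "th = (\<lambda>u. Im (F u + Ln K))"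
  have dth: "th differentiable at u" for u
  proof -
    have "(th has_vector_derivative Im (w' u / w u)) (at u)"
      unfolding th_def
      using bounded_linear.has_vector_derivative[OF bounded_linear_Im F[of u]]
      by (auto intro!: derivative_eq_intros)
    then show ?thesis by (auto simp: differentiable_def has_vector_derivative_def)
  qed
  have nw: "norm (v u) = norm (w u)" for u
    by (simp add: w_def J_def cmod_def norm_vec_def L2_set_def sum_2)
  have "v u = norm (v u) *\<^sub>R tau (th u)" for u
  proof -
    have "w u = norm (w u) *\<^sub>R cis (th u)"
      unfolding w by (simp add: th_def exp_eq_polar scaleR_conv_of_real norm_mult)
    then show ?thesis
      unfolding nw by (simp add: w_def J_def complex_eq_iff vec_eq_iff forall_2 tau_def)
  qed
  with dth show ?thesis
    unfolding tangent_angle_def v_def by blast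
qed

definition curvature :: "(real \<Rightarrow> real^2) \<Rightarrow> (real \<Rightarrow> real) \<Rightarrow> real \<Rightarrow> real" where
  "curvature c th u = deriv th u / norm (velocity c u)"

definition mlength :: "(real^2) set \<Rightarrow> (real \<Rightarrow> real^2) \<Rightarrow> real" where
  "mlength U c = integral {0..2*pi} (\<lambda>u. mnorm U (velocity c u))"

definition mnormal :: "(real \<Rightarrow> real) \<Rightarrow> (real \<Rightarrow> real) \<Rightarrow> real \<Rightarrow> real^2" where
  "mnormal r th u =
     - (deriv (hfun r) (th u)) *\<^sub>R tau (th u) + hfun r (th u) *\<^sub>R nrm (th u)"

definition mcurvature ::
  "(real \<Rightarrow> real) \<Rightarrow> (real \<Rightarrow> real^2) \<Rightarrow> (real \<Rightarrow> real) \<Rightarrow> real \<Rightarrow> real" where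
  "mcurvature r c th u =
     curvature c th u * (deriv (deriv (hfun r)) (th u) + hfun r (th u))"

definition mevolute ::
  "(real \<Rightarrow> real) \<Rightarrow> (real \<Rightarrow> real^2) \<Rightarrow> (real \<Rightarrow> real) \<Rightarrow> real \<Rightarrow> real^2" where
  "mevolute r c th u = c u + inverse (mcurvature r c th u) *\<^sub>R mnormal r th u"

end

theory Submission
  imports Defs
begin

text \<open>Along \<open>\<gamma>\<close> put \<open>\<rho> = 1/\<kappa>\<close> and let \<open>W d\<theta>\<close>, \<open>W = h (h'' + h)\<close>, be twice the area element of
  the isoperimetrix.  Then \<open>d\<sigma> = \<rho> W d\<theta>\<close>, and the evolute has velocity \<open>e' = \<rho>' N\<close>, so that
  an integration by parts gives \<open>\<A>(e) = \<A>(\<gamma>) - 1/2 \<integral> \<rho>\<^sup>2 W d\<theta>\<close>.  Since \<open>\<theta>\<close> grows by exactly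
  \<open>2\<pi>\<close> along \<open>\<gamma>\<close>, the claim is the Cauchy-Schwarz inequality
  \<open>(\<integral> \<rho> W)\<^sup>2 \<le> \<integral> W \<integral> \<rho>\<^sup>2 W\<close>.  The rotation index is 1 because each tangent supports the
  convex region from the same side, so two points with the same tangent direction would have
  the same supporting line, and the open segment between them would lie both on that line and
  in the interior.\<close>

section \<open>The rotating frame and the wedge product in the plane\<close>

lemma tau_nth [simp]: "tau t $ 1 = cos t" "tau t $ 2 = sin t"
  by (simp_all add: tau_def)

lemma nrm_nth [simp]: "nrm t $ 1 = - sin t" "nrm t $ 2 = cos t"
  by (simp_all add: nrm_def)

lemma norm_tau [simp]: "norm (tau t) = 1" and norm_nrm [simp]: "norm (nrm t) = 1"
  by (simp_all add: norm_vec_def L2_set_def sum_2 add.commute)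

lemma tau_periodic: "tau (t + 2 * pi) = tau t"
  by (simp add: vec_eq_iff forall_2)

lemma nrm_periodic: "nrm (t + 2 * pi) = nrm t"
  by (simp add: vec_eq_iff forall_2)

lemma periodic_of_int:
  fixes f :: "real \<Rightarrow> 'a"
  assumes "\<And>u. f (u + p) = f u"
  shows "f (u + p * of_int n) = f u"
proof -
  interpret periodic_fun_simple f p by standard (rule assms)
  show ?thesis using plus_of_int[of u n] by (simp add: mult.commute)
qed

lemma tau_eq_imp:
  assumes "tau x = tau y"
  obtains n :: int where "x = y + 2 * pi * n"
proof -
  have "sin x = sin y \<and> cos x = cos y"
    using assms by (simp add: vec_eq_iff forall_2)
  then show ?thesis using that sin_cos_eq_iff by blast
qed

lemma bounded_bilinear_wedge: "bounded_bilinear wedge"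
  unfolding bilinear_conv_bounded_bilinear[symmetric] bilinear_def
  by (auto intro!: linearI simp: wedge_def algebra_simps)

lemmas wedge_simps = bounded_bilinear.add_left[OF bounded_bilinear_wedge]
  bounded_bilinear.add_right[OF bounded_bilinear_wedge]
  bounded_bilinear.minus_left[OF bounded_bilinear_wedge]
  bounded_bilinear.minus_right[OF bounded_bilinear_wedge]
  bounded_bilinear.diff_left[OF bounded_bilinear_wedge]
  bounded_bilinear.diff_right[OF bounded_bilinear_wedge]
  bounded_bilinear.scaleR_left[OF bounded_bilinear_wedge]
  bounded_bilinear.scaleR_right[OF bounded_bilinear_wedge]

lemma wedge_self [simp]: "wedge x x = 0"
  by (simp add: wedge_def)

lemma wedge_swap: "wedge x y = - wedge y x"
  by (simp add: wedge_def)

lemma wedge_tau_nrm [simp]: "wedge (tau t) (nrm t) = 1" "wedge (nrm t) (tau t) = - 1"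
  using sin_cos_squared_add[of t] by (simp_all add: wedge_def power2_eq_square)

lemma has_vector_derivative_vec2:
  fixes f :: "real \<Rightarrow> real^2"
  assumes "((\<lambda>u. f u $ 1) has_real_derivative a $ 1) (at u)"
    and "((\<lambda>u. f u $ 2) has_real_derivative a $ 2) (at u)"
  shows "(f has_vector_derivative a) (at u)"
proof -
  have "((\<lambda>u. f u $ 1 *\<^sub>R axis 1 1 + f u $ 2 *\<^sub>R axis 2 1 :: real^2)
      has_vector_derivative (a $ 1 *\<^sub>R axis 1 1 + a $ 2 *\<^sub>R axis 2 1)) (at u)"
    by (auto intro!: derivative_eq_intros assms)
  moreover have "(x $ 1 *\<^sub>R axis 1 1 + x $ 2 *\<^sub>R axis 2 (1::real)) = x" for x :: "real^2"
    by (simp add: vec_eq_iff forall_2 axis_def)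
  ultimately show ?thesis by simp
qed

lemma tau_deriv:
  assumes "(f has_real_derivative d) (at u)"
  shows "((\<lambda>u. tau (f u)) has_vector_derivative d *\<^sub>R nrm (f u)) (at u)"
  by (rule has_vector_derivative_vec2) (auto intro!: derivative_eq_intros assms)

lemma nrm_deriv:
  assumes "(f has_real_derivative d) (at u)"
  shows "((\<lambda>u. nrm (f u)) has_vector_derivative - (d *\<^sub>R tau (f u))) (at u)"
  by (rule has_vector_derivative_vec2) (auto intro!: derivative_eq_intros assms)

lemma wedge_deriv:
  assumes "(f has_vector_derivative f') (at u)" "(g has_vector_derivative g') (at u)"
  shows "((\<lambda>u. wedge (f u) (g u)) has_real_derivative wedge (f u) g' + wedge f' (g u)) (at u)"
  using bounded_bilinear.has_vector_derivative[OF bounded_bilinear_wedge assms]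
  by (simp add: has_real_derivative_iff_has_vector_derivative)

lemma continuous_on_wedge [continuous_intros]:
  "continuous_on S f \<Longrightarrow> continuous_on S g \<Longrightarrow> continuous_on S (\<lambda>u. wedge (f u) (g u))"
  by (rule bounded_bilinear.continuous_on[OF bounded_bilinear_wedge])

section \<open>Smooth and periodic functions\<close>

lemma smooth_velocity: "smooth c \<Longrightarrow> smooth (velocity c)"
  unfolding smooth_def
  by (metis funpow.simps(2) funpow_swap1 comp_apply)

lemma smooth_has_velocity:
  "smooth c \<Longrightarrow> (c has_vector_derivative velocity c u) (at u)"
  unfolding smooth_def velocity_def
  by (drule spec[of _ 0]) (simp add: vector_derivative_works)

lemma smooth_continuous_on: "smooth c \<Longrightarrow> continuous_on S c"
  by (meson continuous_at_imp_continuous_on has_vector_derivative_continuous smooth_has_velocity)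

lemma velocity_eq_deriv: "velocity f = deriv f"
  by (simp add: fun_eq_iff velocity_def field_derivative_eq_vector_derivative)

lemma smooth_has_deriv:
  fixes f :: "real \<Rightarrow> real"
  assumes "smooth f"
  shows "(f has_real_derivative deriv f u) (at u)"
  using smooth_has_velocity[OF assms, of u]
  by (simp add: has_real_derivative_iff_has_vector_derivative velocity_eq_deriv)

lemma has_vector_derivative_shift:
  assumes "(f has_vector_derivative d) (at (u + p :: real))"
  shows "((\<lambda>u. f (u + p)) has_vector_derivative d) (at u)"
proof -
  have "((\<lambda>u. u + p) has_vector_derivative 1) (at u)"
    by (auto intro!: derivative_eq_intros)
  from vector_diff_chain_at[OF this assms] show ?thesis by (simp add: o_def)
qed

text \<open>\<open>vector_derivative\<close> chooses among the derivatives at a point; shifting by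
  \<open>p\<close> and by \<open>- p\<close> shows that the candidates at \<open>u + p\<close> and
  at \<open>u\<close> are the same.\<close>

lemma periodic_velocity:
  assumes "\<And>u. c (u + p) = c u"
  shows "velocity c (u + p) = velocity c u"
proof -
  have c: "c (u - p) = c u" for u using assms[of "u - p"] by simp
  have "(c has_vector_derivative d) (at (u + p)) \<longleftrightarrow> (c has_vector_derivative d) (at u)" for d
    using has_vector_derivative_shift[of c d u p] has_vector_derivative_shift[of c d "u + p" "- p"]
    by (auto simp: assms c)
  then show ?thesis by (simp add: velocity_def vector_derivative_def)
qed

subsection \<open>The support function and the isoperimetrix\<close>

locale unit_body =
  fixes U :: "(real^2) set" and r :: "real \<Rightarrow> real"
  assumes body: "minkowski_unit_body U r"
begin

lemma r_pos: "r t > 0" and r_smooth: "smooth r" and r_periodic: "r (t + pi) = r t"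
  using body by (auto simp: minkowski_unit_body_def)

abbreviation "h \<equiv> hfun r"

text \<open>The Euclidean radius of curvature of the isoperimetrix, whose support function in the
  direction \<open>nrm t\<close> is \<open>h\<close>.\<close>

definition "g t = deriv (deriv h) t + h t"

lemma h_pos: "h t > 0" and g_pos: "g t > 0"
  using body by (auto simp: minkowski_unit_body_def hfun_def g_def)

text \<open>Smoothness is given for \<open>r\<close>, so the derivatives of \<open>h = 1/r\<close>
  are computed explicitly. Differentiability of the second one is what makes the Minkowski radius of
  curvature of a curve differentiable.\<close>

lemma
  shows h_deriv: "(h has_real_derivative deriv h t) (at t)"
    and h_deriv2: "(deriv h has_real_derivative deriv (deriv h) t) (at t)"
    and h2_differentiable: "deriv (deriv h) field_differentiable at t"
proof -
  let ?r1 = "deriv r" and ?r2 = "deriv (deriv r)" and ?r3 = "deriv (deriv (deriv r))"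
  have s1: "smooth ?r1" using smooth_velocity[OF r_smooth] by (simp add: velocity_eq_deriv)
  have s2: "smooth ?r2" using smooth_velocity[OF s1] by (simp add: velocity_eq_deriv)
  note D = smooth_has_deriv[OF r_smooth] smooth_has_deriv[OF s1] smooth_has_deriv[OF s2]
  have nz: "r t \<noteq> 0" for t using r_pos[of t] by simp
  have h: "h = (\<lambda>t. inverse (r t))" by (simp add: fun_eq_iff hfun_def)
  have 1: "(h has_real_derivative - ?r1 t / (r t)\<^sup>2) (at t)" for t
    unfolding h by (rule derivative_eq_intros D refl nz | simp add: nz power2_eq_square field_simps)+
  have e1: "deriv h = (\<lambda>t. - ?r1 t / (r t)\<^sup>2)" using 1 by (auto intro!: DERIV_imp_deriv)
  have 2: "(deriv h has_real_derivative (2 * (?r1 t)\<^sup>2 / (r t)^3 - ?r2 t / (r t)\<^sup>2)) (at t)" for t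
    unfolding e1
    by (rule derivative_eq_intros D refl | simp add: nz)+
      (simp add: nz field_simps eval_nat_numeral)
  have e2: "deriv (deriv h) = (\<lambda>t. 2 * (?r1 t)\<^sup>2 / (r t)^3 - ?r2 t / (r t)\<^sup>2)"
    using 2 by (auto intro!: DERIV_imp_deriv)
  have "\<exists>d. (deriv (deriv h) has_real_derivative d) (at t)"
    unfolding e2 by (rule exI) (rule derivative_eq_intros D refl | simp add: nz)+
  then show "deriv (deriv h) field_differentiable at t" by (simp add: field_differentiable_def)
  show "(h has_real_derivative deriv h t) (at t)" using 1 e1 by simp
  show "(deriv h has_real_derivative deriv (deriv h) t) (at t)" using 2 e2 by simp
qed

lemma g_differentiable: "g field_differentiable at t"
proof -
  have "g = (\<lambda>t. deriv (deriv h) t + h t)" by (simp add: fun_eq_iff g_def)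
  then show ?thesis
    using field_differentiable_add[OF h2_differentiable[of t], of h] h_deriv[of t]
    unfolding field_differentiable_def by metis
qed

lemma h_continuous: "continuous_on S h"
  by (rule DERIV_continuous_on[OF has_field_derivative_at_within[OF h_deriv]])

lemma g_continuous: "continuous_on S g"
  using field_differentiable_imp_continuous_at[OF g_differentiable]
  by (simp add: continuous_at_imp_continuous_on)

lemma h_periodic: "h (t + 2 * pi) = h t"
proof -
  have "t + 2 * pi = (t + pi) + pi" by simp
  then show ?thesis unfolding hfun_def by (metis r_periodic)
qed

lemma h_deriv_periodic: "deriv h (t + 2 * pi) = deriv h t"
  using periodic_velocity[of h "2 * pi", OF h_periodic] by (simp add: velocity_eq_deriv)

lemma g_periodic: "g (t + 2 * pi) = g t"
  using periodic_velocity[of "deriv h" "2 * pi", OF h_deriv_periodic] h_periodic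
  by (simp add: g_def velocity_eq_deriv)

text \<open>The two terms along \<open>nrm\<close> cancel. The inner function \<open>f\<close> is
  the identity for the isoperimetrix itself and the tangent angle for the Minkowski normal along a
  curve.\<close>

lemma isoperimetrix_deriv:
  assumes "(f has_real_derivative d) (at u)"
  shows "((\<lambda>u. isoperimetrix r (f u)) has_vector_derivative - ((g (f u) * d) *\<^sub>R tau (f u))) (at u)"
proof -
  have 1: "((\<lambda>u. h (f u)) has_real_derivative deriv h (f u) * d) (at u)"
    using DERIV_chain2[OF h_deriv assms] .
  have 2: "((\<lambda>u. deriv h (f u)) has_real_derivative deriv (deriv h) (f u) * d) (at u)"
    using DERIV_chain2[OF h_deriv2 assms] .
  have 3: "((\<lambda>u. - deriv h (f u)) has_real_derivative - (deriv (deriv h) (f u) * d)) (at u)"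
    using DERIV_minus[OF 2] .
  have "((\<lambda>u. (- deriv h (f u)) *\<^sub>R tau (f u)) has_vector_derivative
      (- deriv h (f u)) *\<^sub>R (d *\<^sub>R nrm (f u)) + (- (deriv (deriv h) (f u) * d)) *\<^sub>R tau (f u)) (at u)"
    by (rule has_vector_derivative_scaleR[OF 3 tau_deriv[OF assms]])
  moreover have "((\<lambda>u. h (f u) *\<^sub>R nrm (f u)) has_vector_derivative
      h (f u) *\<^sub>R (- (d *\<^sub>R tau (f u))) + (deriv h (f u) * d) *\<^sub>R nrm (f u)) (at u)"
    by (rule has_vector_derivative_scaleR[OF 1 nrm_deriv[OF assms]])
  ultimately show ?thesis
    unfolding isoperimetrix_def
    by (rule has_vector_derivative_eq_rhs[OF has_vector_derivative_add])
      (simp add: g_def algebra_simps)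
qed

text \<open>The velocity is a multiple of \<open>tau t\<close>, so the wedge keeps only the
  \<open>nrm\<close> component \<open>h t\<close>.\<close>

lemma signed_area_isoperimetrix:
  "signed_area (isoperimetrix r) = 1/2 * integral {0..2*pi} (\<lambda>t. h t * g t)"
proof -
  have v: "velocity (isoperimetrix r) t = - (g t *\<^sub>R tau t)" for t
    unfolding velocity_def
    using vector_derivative_at[OF isoperimetrix_deriv[of "\<lambda>t. t" 1 t]] by (simp add: DERIV_ident)
  show ?thesis
    unfolding signed_area_def v isoperimetrix_def
    by (simp add: wedge_simps mult.commute)
qed

text \<open>A primitive on the whole line stands in for the change of variables to the tangent
  angle, which starts at an arbitrary value; by periodicity its increment over \<open>2 * pi\<close>
  does not depend on the start.\<close>

lemma hg_antiderivative:
  obtains F where "\<And>t. (F has_real_derivative h t * g t) (at t)"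
    and "\<And>a. F (a + 2 * pi) - F a = 2 * signed_area (isoperimetrix r)"
proof -
  have "continuous_on UNIV (\<lambda>t. h t * g t)"
    by (intro continuous_intros h_continuous g_continuous)
  then have "\<exists>F. \<forall>x :: real. (-\<infinity>::ereal) < x \<longrightarrow> x < (\<infinity>::ereal) \<longrightarrow>
      (F has_vector_derivative (h x * g x)) (at x)"
    by (intro einterval_antiderivative) (auto simp: continuous_on_eq_continuous_at)
  then obtain F where F: "(F has_real_derivative (h x * g x)) (at x)" for x
    by (auto simp: has_real_derivative_iff_has_vector_derivative)
  have "((\<lambda>t. h t * g t) has_integral F (2*pi) - F 0) {0..2*pi}"
    by (rule fundamental_theorem_of_calculus)
      (auto intro!: has_vector_derivative_at_within F[unfolded has_real_derivative_iff_has_vector_derivative])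
  then have I: "F (2*pi) - F 0 = 2 * signed_area (isoperimetrix r)"
    by (simp add: signed_area_isoperimetrix integral_unique)
  have "((\<lambda>t. F (t + 2*pi) - F t) has_real_derivative 0) (at t)" for t
    using DERIV_diff[OF DERIV_shift[THEN iffD1, OF F[of "t + 2*pi"]] F[of t]]
    by (simp add: h_periodic g_periodic)
  then have "F (a + 2*pi) - F a = F (0 + 2*pi) - F 0" for a
    using DERIV_isconst_all[of "\<lambda>t. F (t + 2*pi) - F t" a 0] by simp
  with I F show ?thesis by (intro that) simp_all
qed

text \<open>On the ray through \<open>tau t\<close> the body is the segment up to radius
  \<open>r t = 1 / h t\<close>, so the infimum is over a closed half-line.\<close>

lemma mnorm_tau:
  assumes "\<rho> > 0"
  shows "mnorm U (\<rho> *\<^sub>R tau t) = \<rho> * h t"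
proof -
  have U: "compact U" "convex U" "0 \<in> interior U"
    and fr: "frontier U = {r t *\<^sub>R tau t | t. 0 \<le> t \<and> t < 2*pi}"
    using body by (auto simp: minkowski_unit_body_def)
  \<comment> \<open>The frontier is parametrised over one period only, so \<open>t\<close> is first
    reduced modulo \<open>2 * pi\<close>.\<close>
  have bd: "r t *\<^sub>R tau t \<in> frontier U"
  proof -
    obtain s where s: "0 \<le> s" "s < 2*pi" "cos t = cos s" "sin t = sin s"
      using sincos_total_2pi[of "cos t" "sin t"] by (metis sin_cos_squared_add3 power2_eq_square)
    have tt: "tau t = tau s" using s by (simp add: vec_eq_iff forall_2)
    obtain n :: int where n: "t = s + 2 * pi * n" using tau_eq_imp[OF tt] .
    have per: "r (x + 2*pi) = r x" for x
      using h_periodic[of x] by (simp add: hfun_def)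
    have "r t = r s"
      unfolding n by (rule periodic_of_int[where f = r and p = "2*pi", OF per])
    then show ?thesis unfolding fr using s tt by auto
  qed
  have rU: "r t *\<^sub>R tau t \<in> U"
    using bd U(1) by (metis compact_imp_closed frontier_subset_closed subsetD)
  have 0: "0 \<in> U" using U(3) interior_subset by blast
  have in_iff: "q *\<^sub>R tau t \<in> U \<longleftrightarrow> q \<le> r t" if "q > 0" for q
  proof
    assume "q \<le> r t"
    then have "(1 - q / r t) *\<^sub>R 0 + (q / r t) *\<^sub>R (r t *\<^sub>R tau t) \<in> U"
      using that r_pos[of t] by (intro convexD_alt[OF U(2) 0 rU]) (auto simp: divide_simps)
    then show "q *\<^sub>R tau t \<in> U" using r_pos[of t] by simp
  next
    assume q: "q *\<^sub>R tau t \<in> U"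
    show "q \<le> r t"
    proof (rule ccontr)
      assume c: "\<not> q \<le> r t"
      \<comment> \<open>A point of \<open>U\<close> beyond the boundary point would place that
        boundary point strictly between it and the interior point 0, hence in the interior.\<close>
      have "r t *\<^sub>R tau t \<in> open_segment 0 (q *\<^sub>R tau t)"
        unfolding in_segment using c that r_pos[of t] norm_tau[of t]
        by (auto intro!: exI[of _ "r t / q"] simp del: norm_tau)
      also have "\<dots> \<subseteq> interior U"
        using in_interior_closure_convex_segment[OF U(2,3)] q closure_subset by blast
      finally show False using bd by (simp add: frontier_def)
    qed
  qed
  have "{s. s > 0 \<and> \<rho> *\<^sub>R tau t \<in> (\<lambda>y. s *\<^sub>R y) ` U} = {\<rho> * h t..}"
  proof (intro set_eqI)
    fix s
    have "\<rho> *\<^sub>R tau t \<in> (\<lambda>y. s *\<^sub>R y) ` U \<longleftrightarrow> (\<rho> / s) *\<^sub>R tau t \<in> U" if "s > 0"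
    proof -
      have "\<rho> *\<^sub>R tau t = s *\<^sub>R ((\<rho> / s) *\<^sub>R tau t)" using that by simp
      moreover have "(\<rho> / s) *\<^sub>R tau t = y" if "\<rho> *\<^sub>R tau t = s *\<^sub>R y" for y
      proof -
        have "(\<rho> / s) *\<^sub>R tau t = (1 / s) *\<^sub>R (\<rho> *\<^sub>R tau t)" by simp
        also have "\<dots> = y" unfolding that using \<open>s > 0\<close> by simp
        finally show ?thesis .
      qed
      ultimately show ?thesis by blast
    qed
    moreover have "s > 0" if "\<rho> * h t \<le> s"
      using that assms h_pos[of t] by (meson less_le_trans mult_pos_pos)
    ultimately show "s \<in> {s. s > 0 \<and> \<rho> *\<^sub>R tau t \<in> (\<lambda>y. s *\<^sub>R y) ` U} \<longleftrightarrow> s \<in> {\<rho> * h t..}"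
      using in_iff[of "\<rho> / s"] assms r_pos[of t] by (auto simp: hfun_def field_simps)
  qed
  then show ?thesis by (simp add: mnorm_def)
qed

end

subsection \<open>The tangent angle of a convex curve\<close>

text \<open>One period is compact and has the same image. Closedness makes
  \<open>inside (range c)\<close> open.\<close>

lemma closed_range_curve:
  assumes c: "smooth_closed_curve c"
  shows "closed (range c)"
proof -
  have "range c = c ` {0..2*pi}"
  proof -
    have "c u \<in> c ` {0..2*pi}" for u
    proof -
      have "c u = c (u + 2*pi * of_int (- \<lfloor>u / (2*pi)\<rfloor>))"
        by (rule periodic_of_int[symmetric]) (use c in \<open>auto simp: smooth_closed_curve_def\<close>)
      moreover have "u + 2*pi * of_int (- \<lfloor>u / (2*pi)\<rfloor>) \<in> {0..2*pi}"
        using floor_divide_lower[of "2*pi" u] floor_divide_upper[of "2*pi" u]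
        by (simp add: algebra_simps)
      ultimately show ?thesis by blast
    qed
    then show ?thesis by auto
  qed
  moreover have "continuous_on {0..2*pi} c"
    using c smooth_continuous_on by (auto simp: smooth_closed_curve_def)
  ultimately show ?thesis by (simp add: compact_continuous_image compact_imp_closed)
qed

text \<open>The convex region \<open>K\<close> has a supporting line at \<open>c u\<close> with
  normal \<open>a\<close>. Since \<open>a \<bullet> c w\<close> is minimal at \<open>w = u\<close>,
  this normal is orthogonal to the velocity, and the orientation makes it point to the left.\<close>

lemma supporting_tangent:
  assumes c: "smooth_closed_curve c" "strictly_convex_curve c" "positively_oriented c"
    and x: "x \<in> range c \<union> inside (range c)"
  shows "wedge (velocity c u) (x - c u) \<ge> 0"
proof -
  define K where "K = range c \<union> inside (range c)"
  define v where "v = velocity c u"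
  define J where "J = (vector [- v$2, v$1] :: real^2)"
  have dis: "inside (range c) \<inter> range c = {}" by (simp add: inside_no_overlap)
  have seg: "open_segment x y \<subseteq> inside (range c)" if "x \<in> K" "y \<in> K" for x y
    using c(2) that by (cases "x = y") (auto simp: strictly_convex_curve_def K_def)
  have "convex K"
    unfolding convex_contains_open_segment using seg by (auto simp: K_def)
  have clo: "closed (range c)" by (rule closed_range_curve[OF c(1)])
  \<comment> \<open>A short segment in \<open>K\<close> centred at \<open>c u\<close> would have its
    midpoint inside the curve by strict convexity, yet \<open>c u\<close> lies on the curve.\<close>
  have "c u \<notin> interior K"
  proof
    assume "c u \<in> interior K"
    then obtain e where e: "e > 0" "cball (c u) e \<subseteq> K"
      by (meson mem_interior_cball)
    have "c u \<in> open_segment (c u - e *\<^sub>R axis 1 1) (c u + e *\<^sub>R axis 1 1)"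
    proof -
      have "c u = midpoint (c u - e *\<^sub>R axis 1 1) (c u + e *\<^sub>R axis 1 1)"
        by (simp add: midpoint_def algebra_simps flip: scaleR_2)
      moreover have "c u - e *\<^sub>R axis 1 1 \<noteq> c u + e *\<^sub>R axis 1 1"
        using e(1) by (simp add: vec_eq_iff forall_2 axis_def)
      ultimately show ?thesis by (metis midpoint_in_open_segment)
    qed
    moreover have "c u - e *\<^sub>R axis 1 1 \<in> K" "c u + e *\<^sub>R axis 1 1 \<in> K"
      using e by (auto intro!: subsetD[OF e(2)] simp: dist_norm)
    ultimately show False using seg dis by blast
  qed
  obtain t where t: "t > 0" "c u + t *\<^sub>R J \<in> inside (range c)"
    using eventually_happens[OF eventually_conj[OF c(3)[unfolded positively_oriented_def, rule_format, of u] eventually_at_right_less]]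
    by (auto simp: J_def v_def)
  have int: "inside (range c) \<subseteq> interior K"
    by (rule interior_maximal) (auto simp: K_def open_inside clo)
  \<comment> \<open>The point just to the left of \<open>c u\<close> makes the interior nonempty.
    Hence it is the relative interior, where the supporting inequality is strict;
    \<open>a \<bullet> J > 0\<close> relies on this.\<close>
  then have ri: "rel_interior K = interior K"
    using t by (metis empty_iff rel_interior_nonempty_interior subsetD)
  obtain a where a: "\<And>y. y \<in> K \<Longrightarrow> a \<bullet> c u \<le> a \<bullet> y"
      "\<And>y. y \<in> interior K \<Longrightarrow> a \<bullet> c u < a \<bullet> y"
    using supporting_hyperplane_rel_boundary[OF \<open>convex K\<close>, of "c u"] \<open>c u \<notin> interior K\<close>
    unfolding ri by (metis K_def UnI1 rangeI)
  have "((\<lambda>w. a \<bullet> c w) has_vector_derivative a \<bullet> v) (at u)"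
    unfolding v_def using c(1) smooth_has_velocity
    by (intro bounded_linear.has_vector_derivative[OF bounded_linear_inner_right])
       (auto simp: smooth_closed_curve_def)
  then have "a \<bullet> v = 0"
    by (intro DERIV_local_min[of "\<lambda>w. a \<bullet> c w" _ u 1])
      (auto simp: has_real_derivative_iff_has_vector_derivative K_def intro!: a)
  moreover have "a \<bullet> J > 0"
    using a(2)[of "c u + t *\<^sub>R J"] t int by (auto simp: inner_add_right zero_less_mult_iff)
  moreover have "a \<bullet> x \<ge> a \<bullet> c u" using a x by (auto simp: K_def)
  \<comment> \<open>The expansion of \<open>y\<close> in the orthogonal basis \<open>v\<close>,
    \<open>J\<close>, paired with \<open>a\<close>; here \<open>wedge v y\<close> is
    \<open>J \<bullet> y\<close>.\<close>
  moreover have "(a \<bullet> J) * wedge v y = (norm v)\<^sup>2 * (a \<bullet> y) - (a \<bullet> v) * (v \<bullet> y)" for y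
    by (simp add: J_def wedge_def inner_vec_def power2_norm_eq_inner sum_2 algebra_simps)
  ultimately have "(a \<bullet> J) * wedge v (x - c u) \<ge> 0" "a \<bullet> J > 0"
    by (auto simp: inner_diff_right)
  then show ?thesis by (simp add: zero_le_mult_iff v_def)
qed

text \<open>Both tangent lines have the region on their left, so each contains the other point of
  contact and they coincide. The midpoint of the chord lies on this line and in the open inside,
  which contradicts support.\<close>

lemma tangent_direction_inj:
  assumes c: "smooth_closed_curve c" "simple_closed c" "strictly_convex_curve c" "positively_oriented c"
    and u: "u \<in> {0..<2*pi}" "w \<in> {0..<2*pi}"
    and dir: "velocity c u = norm (velocity c u) *\<^sub>R tau t" "velocity c w = norm (velocity c w) *\<^sub>R tau t"
  shows "u = w"
proof (rule ccontr)
  assume "u \<noteq> w"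
  then have ne: "c u \<noteq> c w" using c(2) u by (auto simp: simple_closed_def inj_on_def)
  have nz: "norm (velocity c z) > 0" for z using c(1) by (simp add: smooth_closed_curve_def)
  have supp: "wedge (tau t) (x - c z) \<ge> 0"
    if "x \<in> range c \<union> inside (range c)" "velocity c z = norm (velocity c z) *\<^sub>R tau t" for x z
  proof -
    have "wedge (norm (velocity c z) *\<^sub>R tau t) (x - c z) \<ge> 0"
      using supporting_tangent[OF c(1,3,4) that(1), of z] that(2) by simp
    then show ?thesis using nz[of z] by (simp add: wedge_simps(7) zero_le_mult_iff)
  qed
  have eq: "wedge (tau t) (c w - c u) = 0"
    using supp[of "c w" u, OF _ dir(1)] supp[of "c u" w, OF _ dir(2)] by (simp add: wedge_simps)
  define m where "m = midpoint (c u) (c w)"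
  have "m \<in> open_segment (c u) (c w)" using ne by (simp add: m_def)
  then have "m \<in> inside (range c)"
    using c(3) ne unfolding strictly_convex_curve_def by blast
  then obtain e where e: "e > 0" "cball m e \<subseteq> inside (range c)"
    using open_inside[OF closed_range_curve[OF c(1)]] by (meson open_contains_cball)
  \<comment> \<open>Moving \<open>m\<close> to the right of the tangent line stays inside the curve
    but makes the wedge equal to \<open>- e\<close>.\<close>
  have "m - e *\<^sub>R nrm t \<in> inside (range c)"
    using e by (intro subsetD[OF e(2)]) (simp add: dist_norm)
  then have "wedge (tau t) (m - e *\<^sub>R nrm t - c u) \<ge> 0" using supp dir(1) by blast
  moreover have "m - e *\<^sub>R nrm t - c u = (1/2) *\<^sub>R (c w - c u) - e *\<^sub>R nrm t"
    by (simp add: m_def midpoint_def vec_eq_iff field_simps)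
  ultimately show False using e(1) eq by (simp add: wedge_simps(5-8))
qed

text \<open>The velocity is periodic, so the increment is \<open>2 * pi * n\<close>, and
  monotonicity gives \<open>n \<ge> 1\<close>. If \<open>n \<ge> 2\<close>, the angle would reach
  \<open>th 0 + 2*pi\<close> strictly within the period and repeat a tangent direction.\<close>

lemma rotation_index_1:
  assumes c: "smooth_closed_curve c" "simple_closed c" "strictly_convex_curve c" "positively_oriented c"
    and th: "tangent_angle c th" "\<And>u. deriv th u > 0"
  shows "th (2*pi) = th 0 + 2*pi"
proof -
  have v: "velocity c u = norm (velocity c u) *\<^sub>R tau (th u)" for u
    using th(1) by (auto simp: tangent_angle_def)
  have d: "(th has_real_derivative deriv th u) (at u)" for u
    using th(1) by (simp add: tangent_angle_def DERIV_deriv_iff_real_differentiable)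
  have "velocity c (0 + 2*pi) = velocity c 0"
    by (rule periodic_velocity) (use c(1) in \<open>auto simp: smooth_closed_curve_def\<close>)
  then have "tau (th (2*pi)) = tau (th 0)"
    using v[of "2*pi"] v[of 0] c(1)
    by (metis add_0 norm_eq_zero scaleR_left_imp_eq smooth_closed_curve_def)
  then obtain n :: int where n: "th (2*pi) = th 0 + 2*pi*n" by (rule tau_eq_imp)
  have "th 0 < th (2*pi)"
    by (rule DERIV_pos_imp_increasing[of 0 "2*pi" th]) (use d th(2) in auto)
  then have "n \<ge> 1" using n by (simp add: zero_less_mult_iff)
  moreover have "n < 2"
  proof (rule ccontr)
    assume "\<not> n < 2"
    then have "2 * pi * 2 \<le> 2 * pi * of_int n"
      by (intro mult_left_mono) auto
    then have le: "th 0 + 2*pi \<le> th (2*pi)" "th 0 + 2*pi \<noteq> th (2*pi)"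
      using n pi_gt_zero by linarith+
    have cont: "continuous_on {0..2*pi} th"
      using d by (meson DERIV_isCont continuous_at_imp_continuous_on)
    obtain w where w: "0 \<le> w" "w \<le> 2*pi" "th w = th 0 + 2*pi"
      using IVT'[of th 0 "th 0 + 2*pi" "2*pi"] le cont by auto
    then have "w \<noteq> 2*pi" "w \<noteq> 0" using le by auto
    moreover have "0 = w"
      by (rule tangent_direction_inj[OF c, of 0 w "th 0"])
        (use w v[of 0] v[of w] \<open>w \<noteq> 2*pi\<close> in \<open>auto simp: tau_periodic\<close>)
    ultimately show False by simp
  qed
  ultimately have "n = 1" by simp
  then show ?thesis using n by simp
qed

subsection \<open>The isoperimetric inequality\<close>

lemma Cauchy_Schwarz_integral_weighted:
  fixes f w :: "real \<Rightarrow> real"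
  assumes "continuous_on {a..b} f" "continuous_on {a..b} w"
    and "\<And>x. x \<in> {a..b} \<Longrightarrow> w x \<ge> 0" and M: "integral {a..b} w > 0"
  shows "(integral {a..b} (\<lambda>x. f x * w x))\<^sup>2 \<le>
    integral {a..b} w * integral {a..b} (\<lambda>x. (f x)\<^sup>2 * w x)"
proof -
  define L M Q where "L = integral {a..b} (\<lambda>x. f x * w x)" and "M = integral {a..b} w"
    and "Q = integral {a..b} (\<lambda>x. (f x)\<^sup>2 * w x)"
  have L: "((\<lambda>x. f x * w x) has_integral L) {a..b}" and M': "(w has_integral M) {a..b}"
    and Q: "((\<lambda>x. (f x)\<^sup>2 * w x) has_integral Q) {a..b}"
    unfolding L_def M_def Q_def
    by (intro integrable_integral integrable_continuous_interval continuous_intros assms(1,2))+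
  \<comment> \<open>The square of \<open>f x - L / M\<close> is integrated against \<open>w\<close>;
    the weighted mean \<open>L / M\<close> is the constant that makes this integral
    smallest.\<close>
  have "((\<lambda>x. (f x)\<^sup>2 * w x - 2 * (L / M) * (f x * w x) + (L / M)\<^sup>2 * w x)
      has_integral Q - 2 * (L / M) * L + (L / M)\<^sup>2 * M) {a..b}"
    by (intro has_integral_add has_integral_diff has_integral_mult_right Q L M')
  moreover have "(f x)\<^sup>2 * w x - 2 * (L / M) * (f x * w x) + (L / M)\<^sup>2 * w x \<ge> 0" if "x \<in> {a..b}" for x
  proof -
    have "(f x - L / M)\<^sup>2 * w x \<ge> 0" using assms(3)[OF that] by simp
    then show ?thesis by (simp add: power2_diff algebra_simps)
  qed
  ultimately have "0 \<le> Q - 2 * (L / M) * L + (L / M)\<^sup>2 * M"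
    by (rule has_integral_nonneg)
  also have "\<dots> = (M * Q - L\<^sup>2) / M"
    using M by (simp add: M_def[symmetric] power2_eq_square field_simps)
  finally show ?thesis
    using M by (simp add: M_def[symmetric] L_def[symmetric] Q_def[symmetric] zero_le_divide_iff)
qed

text \<open>Simplicity, convexity and orientation reach the integrals through the total turning of
  \<open>\<theta>\<close>, which is the premise \<open>rot\<close> of the lemmas that use
  it.\<close>

locale minkowski_curve = unit_body +
  fixes \<gamma> :: "real \<Rightarrow> real^2" and \<theta> :: "real \<Rightarrow> real"
  assumes closed_curve: "smooth_closed_curve \<gamma>" and angle: "tangent_angle \<gamma> \<theta>"
    and mcurvature_pos: "mcurvature r \<gamma> \<theta> u > 0"
begin

abbreviation "v \<equiv> velocity \<gamma>"
abbreviation "N u \<equiv> isoperimetrix r (\<theta> u)"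

definition "\<rho> u = inverse (mcurvature r \<gamma> \<theta> u)"
text \<open>The factor \<open>deriv \<theta>\<close> is included in \<open>W\<close>, since the curve keeps its given parameter \<open>u\<close>.\<close>

definition "W u = h (\<theta> u) * g (\<theta> u) * deriv \<theta> u"

section \<open>Angle, speed and radius of curvature along the curve\<close>

lemma \<gamma>_smooth: "smooth \<gamma>" and \<gamma>_periodic: "\<gamma> (u + 2*pi) = \<gamma> u" and v_nz: "v u \<noteq> 0"
  using closed_curve by (auto simp: smooth_closed_curve_def)

lemma \<theta>_deriv: "(\<theta> has_real_derivative deriv \<theta> u) (at u)"
  using angle by (simp add: tangent_angle_def DERIV_deriv_iff_real_differentiable)

lemma v_eq: "v u = norm (v u) *\<^sub>R tau (\<theta> u)"
  using angle by (auto simp: tangent_angle_def)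

lemma mcurvature_eq: "mcurvature r \<gamma> \<theta> u = deriv \<theta> u / norm (v u) * g (\<theta> u)"
  by (simp add: mcurvature_def curvature_def g_def)

lemma \<theta>_deriv_pos: "deriv \<theta> u > 0"
  using mcurvature_pos[of u] g_pos[of "\<theta> u"] v_nz[of u]
  by (auto simp: mcurvature_eq zero_less_mult_iff zero_less_divide_iff)

text \<open>Differentiating the identity that \<open>v u\<close> is parallel to
  \<open>tau (\<theta> u)\<close> expresses \<open>deriv \<theta>\<close> by derivatives of
  \<open>\<gamma>\<close>, whose regularity it thus inherits; \<open>tangent_angle\<close> by itself
  gives only that \<open>\<theta>\<close> is differentiable.\<close>

lemma \<theta>_deriv_eq: "deriv \<theta> u = wedge (v u) (velocity v u) / (norm (v u))\<^sup>2"
proof -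
  have "wedge (v u) (tau (\<theta> u)) = 0" for u
    by (subst v_eq) (simp add: wedge_simps)
  then have 0: "((\<lambda>u. wedge (v u) (tau (\<theta> u))) has_real_derivative 0) (at u)" by simp
  have "wedge (v u) (deriv \<theta> u *\<^sub>R nrm (\<theta> u)) + wedge (velocity v u) (tau (\<theta> u)) = 0"
    by (rule DERIV_unique[OF wedge_deriv[OF smooth_has_velocity[OF smooth_velocity[OF \<gamma>_smooth]]
          tau_deriv[OF \<theta>_deriv]] 0])
  moreover have "wedge (v u) (nrm (\<theta> u)) = norm (v u)"
    by (subst v_eq) (simp add: wedge_simps)
  ultimately have "deriv \<theta> u * norm (v u) = wedge (tau (\<theta> u)) (velocity v u)"
    by (simp add: wedge_simps wedge_swap[of "tau (\<theta> u)"])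
  moreover have "wedge (v u) (velocity v u) = norm (v u) * wedge (tau (\<theta> u)) (velocity v u)"
    by (subst v_eq) (simp add: wedge_simps)
  ultimately show ?thesis using v_nz[of u] by (simp add: power2_eq_square field_simps)
qed

text \<open>The definition of \<open>\<rho>\<close> solved for the speed; times \<open>h\<close> it
  is the Minkowski arclength density \<open>\<rho> u * W u\<close>.\<close>

lemma speed_eq: "norm (v u) = \<rho> u * g (\<theta> u) * deriv \<theta> u"
  using v_nz[of u] g_pos[of "\<theta> u"] \<theta>_deriv_pos[of u]
  by (simp add: \<rho>_def mcurvature_eq field_simps)

text \<open>With \<open>deriv \<theta>\<close> eliminated, the angle enters through \<open>g\<close>
  alone; this form yields differentiability of \<open>\<rho>\<close> and equal values at the ends of
  the period.\<close>

lemma \<rho>_eq: "\<rho> u = norm (v u) ^ 3 / (wedge (v u) (velocity v u) * g (\<theta> u))"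
  by (simp add: \<rho>_def mcurvature_eq \<theta>_deriv_eq eval_nat_numeral)

lemma \<rho>_deriv: "(\<rho> has_real_derivative deriv \<rho> u) (at u)"
proof -
  have D: "wedge (v u) (velocity v u) \<noteq> 0"
    using \<theta>_deriv_pos[of u] \<theta>_deriv_eq[of u] by auto
  have s: "smooth v" "smooth (velocity v)" using \<gamma>_smooth smooth_velocity by auto
  have 1: "(\<lambda>u. wedge (v u) (velocity v u)) differentiable at u"
    using wedge_deriv[OF s[THEN smooth_has_velocity]] by (auto simp: real_differentiable_def)
  have 2: "(\<lambda>u. norm (v u)) differentiable at u"
    using smooth_has_velocity[OF s(1), of u] v_nz[of u]
    by (intro differentiable_compose[of norm v u UNIV] differentiable_norm_at)
      (auto simp: differentiable_def has_vector_derivative_def)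
  have 3: "(\<lambda>u. g (\<theta> u)) differentiable at u"
    using g_differentiable[of "\<theta> u"] DERIV_chain2[OF _ \<theta>_deriv]
    unfolding field_differentiable_def real_differentiable_def by blast
  have "\<rho> = (\<lambda>u. norm (v u) ^ 3 / (wedge (v u) (velocity v u) * g (\<theta> u)))"
    using \<rho>_eq by blast
  then have "\<rho> differentiable at u"
    using D g_pos[of "\<theta> u"] by (auto intro!: differentiable_divide differentiable_power differentiable_mult 1 2 3)
  then show ?thesis by (simp add: DERIV_deriv_iff_real_differentiable)
qed

lemma
  shows \<theta>_continuous: "continuous_on S \<theta>" and \<rho>_continuous: "continuous_on S \<rho>"
    and \<theta>_deriv_continuous: "continuous_on S (deriv \<theta>)"
proof -
  show "continuous_on S \<theta>" "continuous_on S \<rho>"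
    by (rule DERIV_continuous_on[OF has_field_derivative_at_within], rule \<theta>_deriv \<rho>_deriv)+
  have v: "continuous_on S v" "continuous_on S (velocity v)"
    by (intro smooth_continuous_on smooth_velocity \<gamma>_smooth)+
  have "deriv \<theta> = (\<lambda>u. wedge (v u) (velocity v u) / (norm (v u))\<^sup>2)"
    using \<theta>_deriv_eq by blast
  then show "continuous_on S (deriv \<theta>)"
    using v by (auto intro!: continuous_intros simp: v_nz)
qed

lemma W_continuous: "continuous_on S W"
  unfolding W_def
  by (intro continuous_intros \<theta>_deriv_continuous
      continuous_on_compose2[OF h_continuous[of UNIV] \<theta>_continuous]
      continuous_on_compose2[OF g_continuous[of UNIV] \<theta>_continuous]) auto

lemma W_pos: "W u > 0"
  by (simp add: W_def h_pos g_pos \<theta>_deriv_pos)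

section \<open>Length, evolute and areas as integrals along the curve\<close>

lemma mlength_eq: "mlength U \<gamma> = integral {0..2*pi} (\<lambda>u. \<rho> u * W u)"
proof -
  have "mnorm U (v u) = \<rho> u * W u" for u
  proof -
    have "mnorm U (norm (v u) *\<^sub>R tau (\<theta> u)) = norm (v u) * h (\<theta> u)"
      using v_nz[of u] by (intro mnorm_tau) simp
    then show ?thesis
      unfolding v_eq[symmetric] by (simp add: W_def speed_eq mult_ac)
  qed
  then show ?thesis by (simp add: mlength_def)
qed

lemma mevolute_eq: "mevolute r \<gamma> \<theta> u = \<gamma> u + \<rho> u *\<^sub>R N u"
  by (simp add: mevolute_def \<rho>_def mnormal_def isoperimetrix_def)

text \<open>By \<open>speed_eq\<close>, the tangential term from the turning of the normal cancels
  the velocity of the curve. The singular points of the evolute are the critical points of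
  \<open>\<rho>\<close>.\<close>

lemma velocity_mevolute: "velocity (mevolute r \<gamma> \<theta>) u = deriv \<rho> u *\<^sub>R N u"
proof -
  have "mevolute r \<gamma> \<theta> = (\<lambda>u. \<gamma> u + \<rho> u *\<^sub>R N u)"
    using mevolute_eq by blast
  moreover have "((\<lambda>u. \<gamma> u + \<rho> u *\<^sub>R N u) has_vector_derivative
      v u + (\<rho> u *\<^sub>R (- ((g (\<theta> u) * deriv \<theta> u) *\<^sub>R tau (\<theta> u))) + deriv \<rho> u *\<^sub>R N u)) (at u)"
    by (intro has_vector_derivative_add has_vector_derivative_scaleR \<rho>_deriv
        isoperimetrix_deriv[OF \<theta>_deriv] smooth_has_velocity \<gamma>_smooth)
  moreover have "v u = \<rho> u *\<^sub>R ((g (\<theta> u) * deriv \<theta> u) *\<^sub>R tau (\<theta> u))"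
    by (subst v_eq) (simp add: speed_eq mult.assoc)
  ultimately show ?thesis
    by (simp add: velocity_def vector_derivative_at)
qed

lemma signed_area_mevolute:
  assumes rot: "\<theta> (2*pi) = \<theta> 0 + 2*pi"
  shows "signed_area (mevolute r \<gamma> \<theta>) =
    signed_area \<gamma> - 1/2 * integral {0..2*pi} (\<lambda>u. (\<rho> u)\<^sup>2 * W u)"
proof -
  \<comment> \<open>The boundary term of the integration by parts: the first summand of
    \<open>F'\<close> is the area integrand of the evolute, the rest comes from differentiating the
    wedge.\<close>
  define F where "F u = \<rho> u * wedge (\<gamma> u) (N u)" for u
  define F' where "F' u = deriv \<rho> u * wedge (\<gamma> u) (N u) + ((\<rho> u)\<^sup>2 * W u - wedge (\<gamma> u) (v u))" for u
  have F: "(F has_real_derivative F' u) (at u)" for u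
  proof -
    let ?N' = "- ((g (\<theta> u) * deriv \<theta> u) *\<^sub>R tau (\<theta> u))"
    have "(F has_real_derivative deriv \<rho> u * wedge (\<gamma> u) (N u) +
        (wedge (\<gamma> u) ?N' + wedge (v u) (N u)) * \<rho> u) (at u)"
      unfolding F_def
      by (intro DERIV_mult \<rho>_deriv wedge_deriv isoperimetrix_deriv[OF \<theta>_deriv]
          smooth_has_velocity \<gamma>_smooth)
    moreover have "wedge (\<gamma> u) (v u) = \<rho> u * (g (\<theta> u) * deriv \<theta> u) * wedge (\<gamma> u) (tau (\<theta> u))"
      by (subst v_eq) (simp add: speed_eq wedge_simps)
    moreover have "wedge (v u) (N u) = \<rho> u * W u"
      by (subst v_eq) (simp add: speed_eq wedge_simps isoperimetrix_def W_def)
    ultimately show ?thesis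
      by (simp add: F'_def wedge_simps power2_eq_square algebra_simps)
  qed
  have "v (0 + 2*pi) = v 0" by (rule periodic_velocity[of \<gamma> "2*pi", OF \<gamma>_periodic])
  moreover have "velocity v (0 + 2*pi) = velocity v 0"
    using periodic_velocity[of v "2*pi", OF periodic_velocity[of \<gamma> "2*pi", OF \<gamma>_periodic]] .
  moreover have "N (2*pi) = N 0"
    by (simp add: rot isoperimetrix_def tau_periodic nrm_periodic h_periodic h_deriv_periodic)
  \<comment> \<open>The angle itself is not periodic, but it enters only through
    \<open>2 * pi\<close>-periodic functions.\<close>
  ultimately have "F (2*pi) = F 0"
    using \<gamma>_periodic[of 0] by (simp add: F_def \<rho>_eq rot g_periodic)
  then have F_int: "(F' has_integral 0) {0..2*pi}"
    using fundamental_theorem_of_calculus[of 0 "2*pi" F F'] F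
    by (simp add: has_vector_derivative_at_within has_real_derivative_iff_has_vector_derivative)
  have "((\<lambda>u. (\<rho> u)\<^sup>2 * W u) has_integral integral {0..2*pi} (\<lambda>u. (\<rho> u)\<^sup>2 * W u)) {0..2*pi}"
    by (intro integrable_integral integrable_continuous_interval continuous_intros \<rho>_continuous W_continuous)
  moreover have "((\<lambda>u. wedge (\<gamma> u) (v u)) has_integral 2 * signed_area \<gamma>) {0..2*pi}"
  proof -
    have "(\<lambda>u. wedge (\<gamma> u) (v u)) integrable_on {0..2*pi}"
      by (intro integrable_continuous_interval continuous_intros smooth_continuous_on smooth_velocity \<gamma>_smooth)
    then show ?thesis by (simp add: signed_area_def has_integral_integral)
  qed
  ultimately have "((\<lambda>u. F' u - (\<rho> u)\<^sup>2 * W u + wedge (\<gamma> u) (v u)) has_integral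
      0 - integral {0..2*pi} (\<lambda>u. (\<rho> u)\<^sup>2 * W u) + 2 * signed_area \<gamma>) {0..2*pi}"
    by (intro has_integral_add has_integral_diff F_int)
  \<comment> \<open>The \<open>N\<close> component of the evolute drops out, since its velocity is a
    multiple of \<open>N u\<close>.\<close>
  moreover have "F' u - (\<rho> u)\<^sup>2 * W u + wedge (\<gamma> u) (v u) =
      wedge (mevolute r \<gamma> \<theta> u) (velocity (mevolute r \<gamma> \<theta>) u)" for u
    by (simp add: velocity_mevolute mevolute_eq F'_def wedge_simps)
  ultimately show ?thesis
    by (simp add: signed_area_def integral_unique)
qed

text \<open>A primitive of \<open>h * g\<close> composed with \<open>\<theta>\<close> turns the
  integral into an increment over one full turn.\<close>

lemma integral_W:
  assumes rot: "\<theta> (2*pi) = \<theta> 0 + 2*pi"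
  shows "integral {0..2*pi} W = 2 * signed_area (isoperimetrix r)"
proof -
  obtain F where F: "\<And>t. (F has_real_derivative h t * g t) (at t)"
    and per: "\<And>a. F (a + 2 * pi) - F a = 2 * signed_area (isoperimetrix r)"
    using hg_antiderivative by metis
  have "((\<lambda>u. F (\<theta> u)) has_vector_derivative W u) (at u)" for u
    using DERIV_chain2[OF F \<theta>_deriv]
    by (simp add: W_def has_real_derivative_iff_has_vector_derivative)
  then have "(W has_integral F (\<theta> (2*pi)) - F (\<theta> 0)) {0..2*pi}"
    by (intro fundamental_theorem_of_calculus) (auto intro: has_vector_derivative_at_within)
  then show ?thesis by (simp add: rot per integral_unique)
qed

lemma isoperimetric_inequality:
  assumes rot: "\<theta> (2*pi) = \<theta> 0 + 2*pi"
  shows "(mlength U \<gamma>)\<^sup>2 - 4 * signed_area \<gamma> * signed_area (isoperimetrix r)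
    \<le> 4 * signed_area (isoperimetrix r) * \<bar>signed_area (mevolute r \<gamma> \<theta>)\<bar>"
proof -
  \<comment> \<open>This integral is twice the area of the isoperimetrix. Its positivity serves the
    Cauchy-Schwarz step and the final multiplication by that area.\<close>
  have M: "integral {0..2*pi} W > 0"
  proof -
    have "integral {0..2*pi} W \<ge> 0"
      by (intro integral_nonneg integrable_continuous_interval W_continuous) (simp add: W_pos less_imp_le)
    moreover have "integral {0..2*pi} W = 0 \<longleftrightarrow> (\<forall>u\<in>{0..2*pi}. W u = 0)"
      by (rule integral_eq_0_iff) (auto simp: W_continuous W_pos less_imp_le)
    then have "integral {0..2*pi} W \<noteq> 0"
      using W_pos[of 0] by force
    ultimately show ?thesis by simp
  qed
  let ?I = "signed_area (isoperimetrix r)" and ?E = "signed_area (mevolute r \<gamma> \<theta>)"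
    and ?Q = "integral {0..2*pi} (\<lambda>u. (\<rho> u)\<^sup>2 * W u)"
  have "(mlength U \<gamma>)\<^sup>2 \<le> 2 * ?I * ?Q"
    using Cauchy_Schwarz_integral_weighted[OF \<rho>_continuous W_continuous _ M] W_pos
    by (simp add: mlength_eq integral_W[OF rot] less_imp_le)
  \<comment> \<open>Half of \<open>?Q\<close> is the signed area of the curve minus that of its
    evolute.\<close>
  also have "2 * ?I * ?Q = 4 * ?I * (signed_area \<gamma> + (- ?E))"
    by (simp add: signed_area_mevolute[OF rot] algebra_simps)
  also have "\<dots> \<le> 4 * ?I * (signed_area \<gamma> + \<bar>?E\<bar>)"
    using M integral_W[OF rot] by (intro mult_left_mono) auto
  finally show ?thesis by (simp add: algebra_simps)
qed

end

theorem theorem1: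
  fixes U :: "(real^2) set" and r :: "real \<Rightarrow> real"
    and \<gamma> :: "real \<Rightarrow> real^2" and \<theta> :: "real \<Rightarrow> real"
  assumes "minkowski_unit_body U r"
    and "smooth_closed_curve \<gamma>"
    and "simple_closed \<gamma>"
    and "strictly_convex_curve \<gamma>"
    and "positively_oriented \<gamma>"
    and "tangent_angle \<gamma> \<theta>"
    and "\<And>u. mcurvature r \<gamma> \<theta> u > 0"
  shows "(mlength U \<gamma>)\<^sup>2 - 4 * signed_area \<gamma> * signed_area (isoperimetrix r)
    \<le> 4 * signed_area (isoperimetrix r) * \<bar>signed_area (mevolute r \<gamma> \<theta>)\<bar>"
proof -
  interpret minkowski_curve U r \<gamma> \<theta> by standard (fact assms)+
  \<comment> \<open>Simplicity, strict convexity and orientation enter here.\<close>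
  have "\<theta> (2*pi) = \<theta> 0 + 2*pi"
    using rotation_index_1[OF assms(2-6)] \<theta>_deriv_pos .
  then show ?thesis by (rule isoperimetric_inequality)
qed

end
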